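(* Let $n,m\in\mathbb{N}$. There exists a compact set $\Sigma_{\text{pk}}\subseteq\Sigma_{\text{stab}}$ that does not enable robust stabilization by static state-feedback.
   Context: $\Sigma_{\text{stab}}$ is the set of stabilizable pairs $(A,B)\in\mathbb{R}^{n\times n}\times\mathbb{R}^{n\times m}$, i.e., those for which there exists $K\in\mathbb{R}^{m\times n}$ such that every eigenvalue $\lambda$ of $A+BK$ satisfies $|\lambda|<1$. A set $\Sigma_{\text{pk}}$ of such pairs enables robust stabilization by static state-feedback if there exists a (possibly nonlinear, arbitrary) function $g:\mathbb{R}^n\to\mathbb{R}^m$ such that the discrete-time closed-loop system $x(t+1)=Ax(t)+Bg(x(t))$, $t\in\mathbb{Z}_+=\{0,1,2,\dots\}$, is globally asymptotically stable for all $(A,B)\in\Sigma_{\text{pk}}$. Globally asymptotically stable means: for every $\varepsilon>0$ there is $\delta>0$ such that $\|x(0)\|\le\delta$ implies $\|x(t)\|\le\varepsilon$ for all $t\in\mathbb{Z}_+$, and $\lim_{t\to\infty}x(t)=0$ for every $x(0)\in\mathbb{R}^n$. *)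

theory Defs
  imports "HOL-Analysis.Analysis"
begin

text \<open>Eigenvalues of a real square matrix are complex: the matrix is first mapped into
  the complex matrices.\<close>

definition is_eigenvalue :: "real ^ 'n ^ 'n \<Rightarrow> complex \<Rightarrow> bool" where
  "is_eigenvalue M l \<longleftrightarrow>
     (\<exists>v :: complex ^ 'n. v \<noteq> 0 \<and> map_matrix complex_of_real M *v v = l *s v)"

definition stabilizable_pairs :: "((real ^ 'n ^ 'n) \<times> (real ^ 'm ^ 'n)) set" where
  "stabilizable_pairs =
     {(A, B). \<exists>K :: real ^ 'n ^ 'm. \<forall>l. is_eigenvalue (A + B ** K) l \<longrightarrow> cmod l < 1}"

text \<open>A discrete-time system \<open>x(t+1) = f(x(t))\<close> is given by its right-hand side \<open>f\<close>.\<close>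

definition is_trajectory :: "('a \<Rightarrow> 'a) \<Rightarrow> (nat \<Rightarrow> 'a) \<Rightarrow> bool" where
  "is_trajectory f x \<longleftrightarrow> (\<forall>t. x (Suc t) = f (x t))"

definition globally_asymptotically_stable :: "('a::real_normed_vector \<Rightarrow> 'a) \<Rightarrow> bool" where
  "globally_asymptotically_stable f \<longleftrightarrow>
     (\<forall>\<epsilon>>0. \<exists>\<delta>>0. \<forall>x. is_trajectory f x \<and> norm (x 0) \<le> \<delta> \<longrightarrow> (\<forall>t. norm (x t) \<le> \<epsilon>)) \<and>
     (\<forall>x. is_trajectory f x \<longrightarrow> x \<longlonglongrightarrow> 0)"

definition enables_static_stabilization ::
    "((real ^ 'n ^ 'n) \<times> (real ^ 'm ^ 'n)) set \<Rightarrow> bool" where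
  "enables_static_stabilization S \<longleftrightarrow>
     (\<exists>g :: real ^ 'n \<Rightarrow> real ^ 'm.
        \<forall>(A, B)\<in>S. globally_asymptotically_stable (\<lambda>x. A *v x + B *v g x))"

end

theory Submission
  imports Defs
begin

text \<open>If \<open>\<Sigma>\<close> contains, for every input value \<open>u\<close>, a pair with \<open>A e\<^sub>i + B u = e\<^sub>i\<close>, then every static
  feedback leaves \<open>e\<^sub>i\<close> fixed for some pair in \<open>\<Sigma>\<close>. On the \<open>e\<^sub>i\<close> axis with one active input this asks
  that the scalars \<open>(a, b)\<close> meet each line \<open>a + b k = 1\<close>, as the compact curve \<open>a = \<bar>b\<bar> \<le> 1\<close> does.
  It avoids the nonstabilizable point \<open>(1, 0)\<close> because the limit \<open>\<bar>k\<bar> \<rightarrow> \<infinity>\<close> leads to \<open>(0, 0)\<close>.\<close>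

text \<open>\<open>axis i (axis j 1)\<close> is the matrix unit with its only 1 in row
  \<open>i\<close>, column \<open>j\<close>.\<close>

lemma axis_axis_matrix_vector_mult:
  "axis i (axis j (1::real)) *v u = u $ j *\<^sub>R axis i 1"
  by (simp add: vec_eq_iff matrix_vector_mult_def axis_def if_distrib[of "\<lambda>w. w $ _"]
      if_distrib[of "\<lambda>w. w * _"] cong: if_cong)

lemma axis_axis_matrix_mult:
  "axis i (axis j (1::real)) ** axis j (axis k 1) = axis i (axis k 1)"
  by (simp add: vec_eq_iff matrix_matrix_mult_def axis_def if_distrib[of "\<lambda>w. w $ _"]
      if_distrib[of "\<lambda>w. w * _"] cong: if_cong)

lemma is_eigenvalue_zero_matrix:
  assumes "is_eigenvalue (0 :: real ^ 'n ^ 'n) l"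
  shows "l = 0"
proof -
  obtain v :: "complex ^ 'n" where "v \<noteq> 0" "map_matrix complex_of_real (0 :: real ^ 'n ^ 'n) *v v = l *s v"
    using assms unfolding is_eigenvalue_def by blast
  moreover have "map_matrix complex_of_real (0 :: real ^ 'n ^ 'n) = 0"
    by (simp add: map_matrix_def vec_eq_iff)
  ultimately show ?thesis by simp
qed

lemma stabilizable_pairs_deadbeatI:
  assumes "A + B ** K = 0"
  shows "(A, B) \<in> stabilizable_pairs"
proof -
  have "\<forall>l. is_eigenvalue (A + B ** K) l \<longrightarrow> cmod l < 1"
    by (auto simp: assms dest: is_eigenvalue_zero_matrix)
  then show ?thesis
    unfolding stabilizable_pairs_def by blast
qed

lemma globally_asymptotically_stable_fixed_point:
  assumes "globally_asymptotically_stable f" "f x = x"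
  shows "x = 0"
proof -
  have "is_trajectory f (\<lambda>_. x)"
    using assms(2) by (simp add: is_trajectory_def)
  then have "(\<lambda>_. x) \<longlonglongrightarrow> 0"
    using assms(1) unfolding globally_asymptotically_stable_def by blast
  then show ?thesis by (simp add: LIMSEQ_const_iff)
qed

text \<open>If \<open>b\<close> takes the sign of \<open>k\<close>, the left side becomes
  \<open>\<bar>b\<bar> * (1 + \<bar>k\<bar>)\<close>, which forces
  \<open>\<bar>b\<bar> = 1 / (1 + \<bar>k\<bar>)\<close>, at most 1.\<close>

lemma ex_abs_add_mult_eq_one:
  fixes k :: real
  obtains b where "b \<in> {-1..1}" "\<bar>b\<bar> + b * k = 1"
proof (cases "k \<ge> 0")
  case True
  then show thesis by (intro that[of "1 / (1 + k)"]) (auto simp: field_simps)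
next
  case False
  then show thesis by (intro that[of "- 1 / (1 - k)"]) (auto simp: field_simps)
qed

theorem theorem15:
  shows "\<exists>\<Sigma>pk :: ((real ^ 'n::finite ^ 'n) \<times> (real ^ 'm::finite ^ 'n)) set.
    compact \<Sigma>pk \<and> \<Sigma>pk \<subseteq> stabilizable_pairs \<and> \<not> enables_static_stabilization \<Sigma>pk"
proof -
  obtain i :: 'n and j :: 'm where True by simp
  define A :: "real \<Rightarrow> real ^ 'n ^ 'n" where "A b = \<bar>b\<bar> *\<^sub>R axis i (axis i 1)" for b
  define B :: "real \<Rightarrow> real ^ 'm ^ 'n" where "B b = b *\<^sub>R axis i (axis j 1)" for b
  define S where "S = (\<lambda>b. (A b, B b)) ` {-1..1}"
  have "compact S"
    unfolding S_def A_def B_def by (intro compact_continuous_image continuous_intros) auto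
  moreover have "S \<subseteq> stabilizable_pairs"
  proof -
    \<comment> \<open>Since \<open>b * sgn b = \<bar>b\<bar>\<close>, this gain cancels
      \<open>A b\<close>; at \<open>b = 0\<close> both matrices vanish. The gain depends on the sign
      of \<open>b\<close>, which a common \<open>g\<close> cannot do.\<close>
    have "A b + B b ** (- sgn b *\<^sub>R axis j (axis i 1)) = 0" for b
      unfolding A_def B_def matrix_scalar_ac scalar_matrix_assoc[symmetric] axis_axis_matrix_mult
      by (simp add: abs_sgn mult.commute)
    then show ?thesis
      unfolding S_def using stabilizable_pairs_deadbeatI by blast
  qed
  moreover have "\<not> enables_static_stabilization S"
  proof
    assume "enables_static_stabilization S"
    then obtain g where g: "globally_asymptotically_stable (\<lambda>x. A b *v x + B b *v g x)"
      if "b \<in> {-1..1}" for b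
      unfolding enables_static_stabilization_def S_def by fastforce
    \<comment> \<open>The pair is chosen after \<open>g\<close>, from the single number
      \<open>g (axis i 1) $ j\<close>, so that \<open>axis i 1\<close> becomes a nonzero
      equilibrium.\<close>
    obtain b where b: "b \<in> {-1..1}" "\<bar>b\<bar> + b * g (axis i 1) $ j = 1"
      by (rule ex_abs_add_mult_eq_one)
    have "A b *v axis i 1 + B b *v g (axis i 1) = (\<bar>b\<bar> + b * g (axis i 1) $ j) *\<^sub>R axis i 1"
      by (simp add: A_def B_def scaleR_matrix_vector_assoc[symmetric] axis_axis_matrix_vector_mult
          scaleR_add_left)
    also have "\<dots> = axis i 1"
      by (simp add: b(2))
    finally have "axis i (1::real) = 0"
      by (rule globally_asymptotically_stable_fixed_point[OF g[OF b(1)]])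
    then show False by simp
  qed
  ultimately show ?thesis by blast
qed

end
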